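(* Let $V$ be a unitization of the GPEA $P$, let $\gamma\colon P\to P$ be the corresponding unitizing GPEA-automorphism, and let $U$ be the $\gamma$-unitization of $P$. Then there exists a unique PEA-isomorphism of $U$ onto $V$ that reduces to the identity on $P$, namely the mapping $\phi\colon U\to V$ defined by $\phi a=a$ for $a\in P$ and $\phi x:=(x^{-_U})^{\sim_V}$ for $x\in U\setminus P$.
   Context: A GPEA is a structure $(P;\oplus,0)$ with a partial binary operation $\oplus$ and constant $0$ satisfying: $a\oplus b$ and $(a\oplus b)\oplus c$ exist iff $b\oplus c$ and $a\oplus(b\oplus c)$ exist, and then they are equal; if $a\oplus b$ exists there are $c,d$ with $a\oplus b=c\oplus a=b\oplus d$; cancellation on both sides; $a\oplus 0=0\oplus a=a$; $a\oplus b=0$ implies $a=b=0$. Its induced order is $a\le b$ iff $a\oplus c=b$ for some $c$ (equivalently $d\oplus a=b$ for some $d$); for $a\le b$, $a/b$ is the unique $c$ with $a\oplus c=b$ and $b\backslash a$ is the unique $d$ with $d\oplus a=b$. A PEA is a GPEA with a largest element $1$; in a PEA, $a^{\sim}$ and $a^{-}$ are the unique elements with $a\oplus a^\sim=1=a^-\oplus a$. A GPEA-automorphism $\gamma$ of $P$ is a bijection such that $\gamma$ and $\gamma^{-1}$ preserve existence of sums and the sums; it is unitizing iff for all $a,b\in P$, $\gamma a\oplus b$ is defined iff $b\oplus a$ is defined. A (binary) unitization of $P$ is a PEA $(V;+,0,1)$ with $P\subseteq V$, such that for $a,b\in P$, $a\oplus b$ exists in $P$ iff $a+b$ exists in $V$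 and then they are equal; $1\notin P$; and $x+y$ is undefined for $x,y\in V\setminus P$. For such $V$, the restriction to $P$ of $x\mapsto x^{--}$ on $V$ is a unitizing GPEA-automorphism of $P$, called the unitizing automorphism corresponding to $V$. The $\gamma$-unitization of $P$ (for a unitizing automorphism $\gamma$): take a set $P^\eta$ disjoint from $P$ with a bijection $\eta\colon P\to P^\eta$, put $U=P\cup P^\eta$, $1:=\eta0$, and define $+$ by: (1) for $a,b\in P$, $a+b=a\oplus b$ when defined; (2) $a+\eta b$ is defined iff $a\le b$, and then $a+\eta b=\eta(b\backslash a)$; (3) $\eta a+b$ is defined iff $\gamma b\le a$, and then $\eta a+b=\eta(\gamma b/a)$; (4) $x+y$ is undefined for $x,y\in P^\eta$. Then $U$ is a PEA and a unitization of $P$, with $\eta a=a^\sim$ and $\gamma a=a^{--}$ for $a\in P$. The superscripts $-_U$ and $\sim_V$ indicate the left supplement computed in $U$ and the right supplement computed in $V$. *)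

theory Defs
  imports Main "HOL-Library.FuncSet"
begin

text \<open>A partial binary operation is a function into \<^typ>\<open>'a option\<close>: \<open>psum P a b = Some s\<close> says that
  the sum exists and equals \<open>s\<close>, \<open>psum P a b = None\<close> that it does not exist.  Only the values at
  arguments in the carrier matter.\<close>

record 'a gpea_struct =
  carrier :: "'a set"
  psum :: "'a \<Rightarrow> 'a \<Rightarrow> 'a option"
  zero :: 'a

record 'a pea_struct = "'a gpea_struct" +
  unit :: 'a

definition gle :: "('a, 'm) gpea_struct_scheme \<Rightarrow> 'a \<Rightarrow> 'a \<Rightarrow> bool" where
  "gle P a b \<longleftrightarrow> (\<exists>c\<in>carrier P. psum P a c = Some b)"

text \<open>In \<open>assoc\<close>, equality in the option type says that one side exists iff the other does, and that
  they are then equal.\<close>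

locale gpea =
  fixes P :: "('a, 'm) gpea_struct_scheme"
  assumes zero_closed: "zero P \<in> carrier P"
    and sum_closed: "\<lbrakk>a \<in> carrier P; b \<in> carrier P; psum P a b = Some s\<rbrakk> \<Longrightarrow> s \<in> carrier P"
    and assoc: "\<lbrakk>a \<in> carrier P; b \<in> carrier P; c \<in> carrier P\<rbrakk> \<Longrightarrow>
      Option.bind (psum P a b) (\<lambda>d. psum P d c) = Option.bind (psum P b c) (\<lambda>e. psum P a e)"
    and conjugation: "\<lbrakk>a \<in> carrier P; b \<in> carrier P; psum P a b = Some s\<rbrakk> \<Longrightarrow>
      \<exists>c\<in>carrier P. \<exists>d\<in>carrier P. psum P c a = Some s \<and> psum P b d = Some s"
    and cancel_left: "\<lbrakk>a \<in> carrier P; b \<in> carrier P; c \<in> carrier P;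
      psum P a b = Some s; psum P a c = Some s\<rbrakk> \<Longrightarrow> b = c"
    and cancel_right: "\<lbrakk>a \<in> carrier P; b \<in> carrier P; c \<in> carrier P;
      psum P b a = Some s; psum P c a = Some s\<rbrakk> \<Longrightarrow> b = c"
    and sum_zero: "a \<in> carrier P \<Longrightarrow> psum P a (zero P) = Some a"
    and zero_sum: "a \<in> carrier P \<Longrightarrow> psum P (zero P) a = Some a"
    and positive: "\<lbrakk>a \<in> carrier P; b \<in> carrier P; psum P a b = Some (zero P)\<rbrakk> \<Longrightarrow>
      a = zero P \<and> b = zero P"

locale pea = gpea V for V :: "('a, 'm) pea_struct_scheme" +
  assumes unit_closed: "unit V \<in> carrier V"
    and unit_greatest: "a \<in> carrier V \<Longrightarrow> gle V a (unit V)"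

text \<open>\<open>ldiff P a b\<close> is \<open>a/b\<close> and \<open>rdiff P b a\<close> is \<open>b\a\<close> (both for \<open>a \<le> b\<close>).\<close>

definition ldiff :: "('a, 'm) gpea_struct_scheme \<Rightarrow> 'a \<Rightarrow> 'a \<Rightarrow> 'a" where
  "ldiff P a b = (THE c. c \<in> carrier P \<and> psum P a c = Some b)"

definition rdiff :: "('a, 'm) gpea_struct_scheme \<Rightarrow> 'a \<Rightarrow> 'a \<Rightarrow> 'a" where
  "rdiff P b a = (THE d. d \<in> carrier P \<and> psum P d a = Some b)"

text \<open>\<open>rsupp V a\<close> is \<open>a\<^sup>\<sim>\<close> and \<open>lsupp V a\<close> is \<open>a\<^sup>-\<close>.\<close>

definition rsupp :: "('a, 'm) pea_struct_scheme \<Rightarrow> 'a \<Rightarrow> 'a" where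
  "rsupp V a = (THE c. c \<in> carrier V \<and> psum V a c = Some (unit V))"

definition lsupp :: "('a, 'm) pea_struct_scheme \<Rightarrow> 'a \<Rightarrow> 'a" where
  "lsupp V a = (THE c. c \<in> carrier V \<and> psum V c a = Some (unit V))"

text \<open>Maps between structures are extensional on the carrier, so that equality of morphisms is
  equality of functions.\<close>

definition gpea_hom ::
  "('a, 'm) gpea_struct_scheme \<Rightarrow> ('b, 'n) gpea_struct_scheme \<Rightarrow> ('a \<Rightarrow> 'b) set" where
  "gpea_hom P Q = {\<phi> \<in> carrier P \<rightarrow>\<^sub>E carrier Q.
     \<forall>a\<in>carrier P. \<forall>b\<in>carrier P. \<forall>s. psum P a b = Some s \<longrightarrow> psum Q (\<phi> a) (\<phi> b) = Some (\<phi> s)}"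

definition gpea_iso ::
  "('a, 'm) gpea_struct_scheme \<Rightarrow> ('b, 'n) gpea_struct_scheme \<Rightarrow> ('a \<Rightarrow> 'b) set" where
  "gpea_iso P Q = {\<phi> \<in> gpea_hom P Q. bij_betw \<phi> (carrier P) (carrier Q) \<and>
     restrict (inv_into (carrier P) \<phi>) (carrier Q) \<in> gpea_hom Q P}"

definition pea_iso ::
  "('a, 'm) pea_struct_scheme \<Rightarrow> ('b, 'n) pea_struct_scheme \<Rightarrow> ('a \<Rightarrow> 'b) set" where
  "pea_iso U V = {\<phi> \<in> gpea_iso U V. pea U \<and> pea V \<and> \<phi> (unit U) = unit V}"

definition unitizing_aut :: "('a, 'm) gpea_struct_scheme \<Rightarrow> ('a \<Rightarrow> 'a) \<Rightarrow> bool" where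
  "unitizing_aut P \<gamma> \<longleftrightarrow> \<gamma> \<in> gpea_iso P P \<and>
     (\<forall>a\<in>carrier P. \<forall>b\<in>carrier P. psum P (\<gamma> a) b \<noteq> None \<longleftrightarrow> psum P b a \<noteq> None)"

locale unitization = gpea P + V: pea V
  for P :: "('a, 'm) gpea_struct_scheme" and V :: "('a, 'n) pea_struct_scheme" +
  assumes subset: "carrier P \<subseteq> carrier V"
    and same_zero: "zero V = zero P"
    and same_sum: "\<lbrakk>a \<in> carrier P; b \<in> carrier P\<rbrakk> \<Longrightarrow> psum V a b = psum P a b"
    and unit_notin: "unit V \<notin> carrier P"
    and no_sum: "\<lbrakk>x \<in> carrier V - carrier P; y \<in> carrier V - carrier P\<rbrakk> \<Longrightarrow> psum V x y = None"

definition corresponding_aut ::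
  "('a, 'm) gpea_struct_scheme \<Rightarrow> ('a, 'n) pea_struct_scheme \<Rightarrow> 'a \<Rightarrow> 'a" where
  "corresponding_aut P V = restrict (\<lambda>x. lsupp V (lsupp V x)) (carrier P)"

context gpea
begin

lemma assoc1:
  assumes "a \<in> carrier P" "b \<in> carrier P" "c \<in> carrier P"
    and "psum P a b = Some d" "psum P d c = Some s"
  obtains e where "e \<in> carrier P" "psum P b c = Some e" "psum P a e = Some s"
  using assoc[OF assms(1-3)] assms sum_closed[OF assms(2,3)]
  by (cases "psum P b c") auto

lemma assoc2:
  assumes "a \<in> carrier P" "b \<in> carrier P" "c \<in> carrier P"
    and "psum P b c = Some e" "psum P a e = Some s"
  obtains d where "d \<in> carrier P" "psum P a b = Some d" "psum P d c = Some s"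
  using assoc[OF assms(1-3)] assms sum_closed[OF assms(1,2)]
  by (cases "psum P a b") auto

end

context pea
begin

lemma rsupp:
  assumes "a \<in> carrier V"
  shows rsupp_closed: "rsupp V a \<in> carrier V"
    and rsupp_sum: "psum V a (rsupp V a) = Some (unit V)"
proof -
  obtain c where c: "c \<in> carrier V" "psum V a c = Some (unit V)"
    using unit_greatest[OF assms] unfolding gle_def by blast
  have "rsupp V a \<in> carrier V \<and> psum V a (rsupp V a) = Some (unit V)"
    unfolding rsupp_def
  proof (rule theI)
    show "c \<in> carrier V \<and> psum V a c = Some (unit V)" using c by blast
    show "x = c" if "x \<in> carrier V \<and> psum V a x = Some (unit V)" for x
      using cancel_left[OF assms _ c(1) _ c(2)] that by blast
  qed
  then show "rsupp V a \<in> carrier V" "psum V a (rsupp V a) = Some (unit V)" by auto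
qed

lemma lsupp:
  assumes "a \<in> carrier V"
  shows lsupp_closed: "lsupp V a \<in> carrier V"
    and lsupp_sum: "psum V (lsupp V a) a = Some (unit V)"
proof -
  obtain c where c: "c \<in> carrier V" "psum V c a = Some (unit V)"
    using conjugation[OF assms rsupp_closed[OF assms] rsupp_sum[OF assms]] by blast
  have "lsupp V a \<in> carrier V \<and> psum V (lsupp V a) a = Some (unit V)"
    unfolding lsupp_def
  proof (rule theI)
    show "c \<in> carrier V \<and> psum V c a = Some (unit V)" using c by blast
    show "x = c" if "x \<in> carrier V \<and> psum V x a = Some (unit V)" for x
      using cancel_right[OF assms _ c(1) _ c(2)] that by blast
  qed
  then show "lsupp V a \<in> carrier V" "psum V (lsupp V a) a = Some (unit V)" by auto
qed

lemma rsupp_eqI: "\<lbrakk>a \<in> carrier V; c \<in> carrier V; psum V a c = Some (unit V)\<rbrakk> \<Longrightarrow> rsupp V a = c"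
  using cancel_left[of a "rsupp V a" c "unit V"] rsupp_closed[of a] rsupp_sum[of a] by blast

lemma lsupp_eqI: "\<lbrakk>a \<in> carrier V; c \<in> carrier V; psum V c a = Some (unit V)\<rbrakk> \<Longrightarrow> lsupp V a = c"
  using cancel_right[of a "lsupp V a" c "unit V"] lsupp_closed[of a] lsupp_sum[of a] by blast

lemma rsupp_lsupp: "a \<in> carrier V \<Longrightarrow> rsupp V (lsupp V a) = a"
  and lsupp_rsupp: "a \<in> carrier V \<Longrightarrow> lsupp V (rsupp V a) = a"
  by (simp_all add: lsupp rsupp lsupp_eqI rsupp_eqI)

lemma sum_lsupp:
  assumes ab: "a \<in> carrier V" "b \<in> carrier V" and s: "psum V a b = Some s"
  shows "psum V (lsupp V s) a = Some (lsupp V b)"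
proof -
  have sc: "s \<in> carrier V" using ab s by (rule sum_closed)
  obtain d where "d \<in> carrier V" "psum V (lsupp V s) a = Some d" "psum V d b = Some (unit V)"
    using assoc2[OF lsupp_closed[OF sc] ab s lsupp_sum[OF sc]] .
  then show ?thesis using lsupp_eqI[OF ab(2)] by simp
qed

lemma sum_rsupp:
  assumes ab: "a \<in> carrier V" "b \<in> carrier V" and s: "psum V a b = Some s"
  shows "psum V b (rsupp V s) = Some (rsupp V a)"
proof -
  have sc: "s \<in> carrier V" using ab s by (rule sum_closed)
  obtain d where "d \<in> carrier V" "psum V b (rsupp V s) = Some d" "psum V a d = Some (unit V)"
    using assoc1[OF ab rsupp_closed[OF sc] s rsupp_sum[OF sc]] .
  then show ?thesis using rsupp_eqI[OF ab(1)] by simp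
qed

lemma lsupp2_sum:
  assumes "a \<in> carrier V" "b \<in> carrier V" "psum V a b = Some s"
  shows "psum V (lsupp V (lsupp V a)) (lsupp V (lsupp V b)) = Some (lsupp V (lsupp V s))"
proof -
  have sc: "s \<in> carrier V" using assms by (rule sum_closed)
  have "psum V (lsupp V (lsupp V b)) (lsupp V s) = Some (lsupp V a)"
    by (rule sum_lsupp[OF lsupp_closed[OF sc] assms(1) sum_lsupp[OF assms]])
  then show ?thesis
    by (rule sum_lsupp[OF lsupp_closed[OF lsupp_closed[OF assms(2)]] lsupp_closed[OF sc]])
qed

lemma rsupp2_sum:
  assumes "a \<in> carrier V" "b \<in> carrier V" "psum V a b = Some s"
  shows "psum V (rsupp V (rsupp V a)) (rsupp V (rsupp V b)) = Some (rsupp V (rsupp V s))"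
proof -
  have sc: "s \<in> carrier V" using assms by (rule sum_closed)
  have "psum V (rsupp V s) (rsupp V (rsupp V a)) = Some (rsupp V b)"
    by (rule sum_rsupp[OF assms(2) rsupp_closed[OF sc] sum_rsupp[OF assms]])
  then show ?thesis
    by (rule sum_rsupp[OF rsupp_closed[OF sc] rsupp_closed[OF rsupp_closed[OF assms(1)]]])
qed

lemma lsupp2_commute:
  assumes a: "a \<in> carrier V" and b: "b \<in> carrier V"
  shows "psum V (lsupp V (lsupp V a)) b \<noteq> None \<longleftrightarrow> psum V b a \<noteq> None" (is "?L \<longleftrightarrow> ?R")
proof
  assume ?L
  then obtain s where s: "psum V (lsupp V (lsupp V a)) b = Some s" by blast
  have "psum V b (rsupp V s) = Some (lsupp V a)"
    using sum_rsupp[OF _ b s] a by (simp add: lsupp_closed rsupp_lsupp)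
  moreover have "rsupp V s \<in> carrier V" using rsupp_closed[OF sum_closed[OF _ b s]] a by (simp add: lsupp_closed)
  ultimately obtain c where "c \<in> carrier V" "psum V c b = Some (lsupp V a)"
    using conjugation[OF b] by blast
  then obtain e where "psum V b a = Some e" by (rule assoc1[OF _ b a _ lsupp_sum[OF a]])
  then show ?R by simp
next
  assume ?R
  then obtain s where s: "psum V b a = Some s" by blast
  have sc: "s \<in> carrier V" using s sum_closed a b by blast
  have "psum V (lsupp V s) b = Some (lsupp V a)" using sum_lsupp[OF b a s] .
  then obtain c where "c \<in> carrier V" "psum V b c = Some (lsupp V a)"
    using conjugation[OF lsupp_closed[OF sc] b] by blast
  then obtain d where "psum V (lsupp V (lsupp V a)) b = Some d"
    by (rule assoc2[OF lsupp_closed[OF lsupp_closed[OF a]] b _ _ lsupp_sum[OF lsupp_closed[OF a]]])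
  then show ?L by simp
qed

end

context unitization
begin

lemma sum_unit_notin:
  assumes "a \<in> carrier V" "b \<in> carrier V" "psum V a b = Some (unit V)"
  shows "a \<in> carrier P \<longleftrightarrow> b \<notin> carrier P"
proof -
  have "\<not> (a \<in> carrier P \<and> b \<in> carrier P)"
    using assms(3) same_sum[of a b] sum_closed[of a b "unit V"] unit_notin by auto
  moreover have "a \<in> carrier P \<or> b \<in> carrier P"
    using assms no_sum[of a b] by auto
  ultimately show ?thesis by blast
qed

lemma lsupp_mem_iff: "a \<in> carrier V \<Longrightarrow> lsupp V a \<in> carrier P \<longleftrightarrow> a \<notin> carrier P"
  using sum_unit_notin[OF V.lsupp_closed _ V.lsupp_sum] by blast

lemma rsupp_mem_iff: "a \<in> carrier V \<Longrightarrow> rsupp V a \<in> carrier P \<longleftrightarrow> a \<notin> carrier P"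
  using sum_unit_notin[OF _ V.rsupp_closed V.rsupp_sum] by blast

lemma unitizing_corresponding_aut: "unitizing_aut P (corresponding_aut P V)"
proof -
  let ?g = "corresponding_aut P V"
  let ?h = "restrict (\<lambda>x. rsupp V (rsupp V x)) (carrier P)"
  have [simp]: "a \<in> carrier V" if "a \<in> carrier P" for a using that subset by blast
  have g: "?g a = lsupp V (lsupp V a)" "?g a \<in> carrier P" if "a \<in> carrier P" for a
    using that by (simp_all add: corresponding_aut_def lsupp_mem_iff V.lsupp_closed)
  have h: "?h a = rsupp V (rsupp V a)" "?h a \<in> carrier P" if "a \<in> carrier P" for a
    using that by (simp_all add: rsupp_mem_iff V.rsupp_closed)
  have gh: "?g (?h a) = a" "?h (?g a) = a" if "a \<in> carrier P" for a
    using that g h by (simp_all add: V.lsupp_rsupp V.rsupp_lsupp V.lsupp_closed V.rsupp_closed)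
  have bij: "bij_betw ?g (carrier P) (carrier P)"
    by (rule bij_betw_byWitness[of _ ?h]) (use gh g h in auto)
  have inv: "restrict (inv_into (carrier P) ?g) (carrier P) = ?h"
  proof (rule restrict_ext)
    fix a assume a: "a \<in> carrier P"
    show "inv_into (carrier P) ?g a = rsupp V (rsupp V a)"
      using bij_betw_imp_inj_on[OF bij] h(2)[OF a] gh(1)[OF a] unfolding h(1)[OF a]
      by (rule inv_into_f_eq)
  qed
  have "?g \<in> gpea_hom P P"
  proof -
    have "?g \<in> carrier P \<rightarrow>\<^sub>E carrier P" using g(2) by (auto simp: corresponding_aut_def)
    moreover have "psum P (?g a) (?g b) = Some (?g s)"
      if "a \<in> carrier P" "b \<in> carrier P" "psum P a b = Some s" for a b s
      using that V.lsupp2_sum[of a b s] sum_closed[OF that] same_sum[of a b]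
        same_sum[of "?g a" "?g b"] g by simp
    ultimately show ?thesis unfolding gpea_hom_def by blast
  qed
  moreover have "?h \<in> gpea_hom P P"
  proof -
    have "?h \<in> carrier P \<rightarrow>\<^sub>E carrier P" using h(2) by auto
    moreover have "psum P (?h a) (?h b) = Some (?h s)"
      if "a \<in> carrier P" "b \<in> carrier P" "psum P a b = Some s" for a b s
      using that V.rsupp2_sum[of a b s] sum_closed[OF that] same_sum[of a b]
        same_sum[of "?h a" "?h b"] h by simp
    ultimately show ?thesis unfolding gpea_hom_def by blast
  qed
  moreover have "psum P (?g a) b \<noteq> None \<longleftrightarrow> psum P b a \<noteq> None"
    if "a \<in> carrier P" "b \<in> carrier P" for a b
    using that g V.lsupp2_commute[of a b] by (simp flip: same_sum)
  ultimately show ?thesis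
    unfolding unitizing_aut_def gpea_iso_def using bij inv by auto
qed

end

text \<open>Here \<open>P\<^sup>\<eta>\<close> is the image of the carrier of \<open>P\<close> under \<open>\<eta>\<close>; the definition is meant for \<open>\<eta>\<close> injective
  on the carrier with image disjoint from it.  The element \<open>b\<close> (resp. \<open>a\<close>) below is the one with
  \<open>y = \<eta> b\<close> (resp. \<open>x = \<eta> a\<close>).\<close>

definition gamma_unitization ::
  "('a, 'm) gpea_struct_scheme \<Rightarrow> ('a \<Rightarrow> 'a) \<Rightarrow> ('a \<Rightarrow> 'a) \<Rightarrow> 'a pea_struct" where
  "gamma_unitization P \<gamma> \<eta> =
    \<lparr>carrier = carrier P \<union> \<eta> ` carrier P,
     psum = (\<lambda>x y.
       if x \<in> carrier P \<and> y \<in> carrier P then psum P x y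
       else if x \<in> carrier P \<and> y \<in> \<eta> ` carrier P then
         (let b = inv_into (carrier P) \<eta> y in
            if gle P x b then Some (\<eta> (rdiff P b x)) else None)
       else if x \<in> \<eta> ` carrier P \<and> y \<in> carrier P then
         (let a = inv_into (carrier P) \<eta> x in
            if gle P (\<gamma> y) a then Some (\<eta> (ldiff P (\<gamma> y) a)) else None)
       else None),
     zero = zero P,
     unit = \<eta> (zero P)\<rparr>"

end

(* A unitization V is the disjoint union of P and of the right supplements of elements of P, and P is
   an order ideal of V.  The supplement laws "d + a = b implies a + b~ = d~" and "b-- + c = a implies
   a~ + b = c~" show that the mixed sums of V are given by the formulas (2) and (3) of the
   gamma-unitization, once eta b is read as b~.  Hence the map fixing P and sending eta b to b~ is a
   bijection U -> V transporting the partial sum, which makes U a PEA isomorphic to V.  Uniqueness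
   holds because b + eta b = 1 forces the image of eta b. *)

theory Submission
  imports Defs
begin

section \<open>Order and differences in a GPEA\<close>

context gpea
begin

lemma ldiff_eqI:
  assumes "a \<in> carrier P" "c \<in> carrier P" "psum P a c = Some b"
  shows "ldiff P a b = c"
  unfolding ldiff_def by (rule the_equality) (use assms cancel_left in blast)+

lemma rdiff_eqI:
  assumes "a \<in> carrier P" "d \<in> carrier P" "psum P d a = Some b"
  shows "rdiff P b a = d"
  unfolding rdiff_def by (rule the_equality) (use assms cancel_right in blast)+

text \<open>Conjugation carries \<open>a\<close> from either side of a sum to the other, so
  \<open>ldiff\<close> and \<open>rdiff\<close> exist under the same order.\<close>

lemma gle_iff_right_summand:
  assumes "a \<in> carrier P"
  shows "gle P a b \<longleftrightarrow> (\<exists>d\<in>carrier P. psum P d a = Some b)"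
  unfolding gle_def using conjugation assms by meson

lemma ldiff:
  assumes "a \<in> carrier P" "gle P a b"
  shows ldiff_closed: "ldiff P a b \<in> carrier P"
    and ldiff_sum: "psum P a (ldiff P a b) = Some b"
  using assms ldiff_eqI unfolding gle_def by auto

lemma rdiff:
  assumes "a \<in> carrier P" "gle P a b"
  shows rdiff_closed: "rdiff P b a \<in> carrier P"
    and rdiff_sum: "psum P (rdiff P b a) a = Some b"
  using assms rdiff_eqI unfolding gle_iff_right_summand[OF assms(1)] by auto

lemma gle_refl: "a \<in> carrier P \<Longrightarrow> gle P a a"
  unfolding gle_def using sum_zero zero_closed by blast

lemma rdiff_self: "a \<in> carrier P \<Longrightarrow> rdiff P a a = zero P"
  by (intro rdiff_eqI zero_sum zero_closed)

end

lemma (in pea) rsupp_zero: "rsupp V (zero V) = unit V"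
  by (intro rsupp_eqI zero_closed unit_closed zero_sum)

section \<open>Sums in V of an element of P and one outside P\<close>

context unitization
begin

lemma mem_V: "a \<in> carrier P \<Longrightarrow> a \<in> carrier V"
  using subset by blast

text \<open>Since s lies in P, s~ lies outside P, and y + s~ exists (it equals x~). Two elements
  outside P have no sum, so y is in P. With \<open>left_summand_mem\<close> this makes P an order
  ideal of V.\<close>

lemma right_summand_mem:
  assumes x: "x \<in> carrier V" and y: "y \<in> carrier V"
    and s: "psum V x y = Some s" "s \<in> carrier P"
  shows "y \<in> carrier P"
proof (rule ccontr)
  assume "y \<notin> carrier P"
  moreover have "rsupp V s \<in> carrier V - carrier P"
    using s(2) mem_V V.rsupp_closed rsupp_mem_iff by blast
  moreover obtain e where "psum V y (rsupp V s) = Some e"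
    using V.sum_rsupp[OF x y s(1)] by blast
  ultimately show False using no_sum[of y "rsupp V s"] y by simp
qed

lemma left_summand_mem:
  assumes x: "x \<in> carrier V" and y: "y \<in> carrier V"
    and s: "psum V x y = Some s" "s \<in> carrier P"
  shows "x \<in> carrier P"
proof -
  \<comment> \<open>Conjugation makes x a right summand of s.\<close>
  obtain c where "c \<in> carrier V" "psum V c x = Some s"
    using V.conjugation[OF x y s(1)] by blast
  then show ?thesis using right_summand_mem x s(2) by blast
qed

lemma sum_rsupp_right:
  assumes a: "a \<in> carrier P" and b: "b \<in> carrier P"
  shows "psum V a (rsupp V b) = (if gle P a b then Some (rsupp V (rdiff P b a)) else None)"
proof (cases "gle P a b")
  case True
  note d = rdiff[OF a True]
  have "psum V (rdiff P b a) a = Some b" using d a by (simp add: same_sum)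
  from V.sum_rsupp[OF mem_V[OF d(1)] mem_V[OF a] this] show ?thesis using True by simp
next
  case False
  have "psum V a (rsupp V b) = None"
  proof (rule ccontr)
    assume "psum V a (rsupp V b) \<noteq> None"
    then obtain s where s: "psum V a (rsupp V b) = Some s" by blast
    have bV: "rsupp V b \<in> carrier V" using b by (simp add: mem_V V.rsupp_closed)
    have sV: "s \<in> carrier V" using V.sum_closed[OF mem_V[OF a] bV s] .
    have "rsupp V b \<notin> carrier P" using b by (simp add: mem_V rsupp_mem_iff)
    \<comment> \<open>Since s has the summand b~ outside the order ideal P, s is outside P too. Its
      left supplement is then in P and serves as the difference of b and a.\<close>
    then have "s \<notin> carrier P" using right_summand_mem[OF mem_V[OF a] bV s] by blast
    then have sP: "lsupp V s \<in> carrier P" using sV by (simp add: lsupp_mem_iff)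
    have "psum V (lsupp V s) a = Some b"
      using V.sum_lsupp[OF mem_V[OF a] bV s] b by (simp add: mem_V V.lsupp_rsupp)
    then have "psum P (lsupp V s) a = Some b" using sP a by (simp add: same_sum)
    then show False using False sP gle_iff_right_summand[OF a] by blast
  qed
  then show ?thesis using False by simp
qed

lemma corresponding_aut_eq: "a \<in> carrier P \<Longrightarrow> corresponding_aut P V a = lsupp V (lsupp V a)"
  by (simp add: corresponding_aut_def)

lemma corresponding_aut_closed: "a \<in> carrier P \<Longrightarrow> corresponding_aut P V a \<in> carrier P"
  by (simp add: corresponding_aut_def lsupp_mem_iff V.lsupp_closed mem_V)

text \<open>The supplement law is used twice, which is where the double supplement g = b^-- comes
  from. From g + c = a follows c + a~ = g~ = b^-, and from that a~ + b = c~. Conversely, a~ + b = s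
  gives s^- + a~ = b^-, and then g + s^- = a.\<close>

lemma sum_rsupp_left:
  assumes a: "a \<in> carrier P" and b: "b \<in> carrier P"
  defines "g \<equiv> corresponding_aut P V b"
  shows "psum V (rsupp V a) b = (if gle P g a then Some (rsupp V (ldiff P g a)) else None)"
proof -
  have g: "g \<in> carrier P" and g_eq: "g = lsupp V (lsupp V b)"
    unfolding g_def using b corresponding_aut_eq corresponding_aut_closed by auto
  have aV: "rsupp V a \<in> carrier V" using a by (simp add: mem_V V.rsupp_closed)
  show ?thesis
  proof (cases "gle P g a")
    case True
    note c = ldiff[OF g True]
    have "psum V g (ldiff P g a) = Some a" using c g by (simp add: same_sum)
    from V.sum_rsupp[OF mem_V[OF g] mem_V[OF c(1)] this]
    have "psum V (ldiff P g a) (rsupp V a) = Some (lsupp V b)"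
      using b by (simp add: g_eq V.rsupp_lsupp V.lsupp_closed mem_V)
    from V.sum_rsupp[OF mem_V[OF c(1)] aV this] show ?thesis
      using True b by (simp add: V.rsupp_lsupp mem_V)
  next
    case False
    have "psum V (rsupp V a) b = None"
    proof (rule ccontr)
      assume "psum V (rsupp V a) b \<noteq> None"
      then obtain s where s: "psum V (rsupp V a) b = Some s" by blast
      have sV: "s \<in> carrier V" using V.sum_closed[OF aV mem_V[OF b] s] .
      have "rsupp V a \<notin> carrier P" using a by (simp add: mem_V rsupp_mem_iff)
      then have "s \<notin> carrier P" using left_summand_mem[OF aV mem_V[OF b] s] by blast
      then have sP: "lsupp V s \<in> carrier P" using sV by (simp add: lsupp_mem_iff)
      have "psum V g (lsupp V s) = Some a"
        using V.sum_lsupp[OF mem_V[OF sP] aV V.sum_lsupp[OF aV mem_V[OF b] s]] a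
        by (simp add: g_eq mem_V V.lsupp_rsupp)
      then have "psum P g (lsupp V s) = Some a" using sP g by (simp add: same_sum)
      then show False using False sP unfolding gle_def by blast
    qed
    then show ?thesis using False by simp
  qed
qed

end

section \<open>Isomorphisms and transport of a PEA structure along a bijection\<close>

lemma gpea_isoD:
  assumes "\<psi> \<in> gpea_iso U V" "x \<in> carrier U" "y \<in> carrier U" "psum U x y = Some s"
  shows "psum V (\<psi> x) (\<psi> y) = Some (\<psi> s)"
  using assms unfolding gpea_iso_def gpea_hom_def by blast

text \<open>U is a bare structure here; its axioms are to be pulled back from V. The
  \<open>map_option\<close> equation transports existence and value of sums together. Closure is a
  separate assumption, since \<open>f\<close> is injective only on \<open>carrier U\<close> and
  cannot detect values outside it.\<close>

locale sum_transport = V: pea V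
  for U :: "('a, 'm) pea_struct_scheme" and V :: "('b, 'n) pea_struct_scheme"
    and f :: "'a \<Rightarrow> 'b" +
  assumes bij: "bij_betw f (carrier U) (carrier V)"
    and U_sum_closed: "\<lbrakk>x \<in> carrier U; y \<in> carrier U; psum U x y = Some s\<rbrakk> \<Longrightarrow> s \<in> carrier U"
    and transport: "\<lbrakk>x \<in> carrier U; y \<in> carrier U\<rbrakk> \<Longrightarrow>
      psum V (f x) (f y) = map_option f (psum U x y)"
    and U_zero_closed: "zero U \<in> carrier U"
    and f_zero: "f (zero U) = zero V"
    and U_unit_closed: "unit U \<in> carrier U"
    and f_unit: "f (unit U) = unit V"
begin

lemma f_closed: "x \<in> carrier U \<Longrightarrow> f x \<in> carrier V"
  using bij bij_betwE by blast

lemma f_eq_iff: "\<lbrakk>x \<in> carrier U; y \<in> carrier U\<rbrakk> \<Longrightarrow> f x = f y \<longleftrightarrow> x = y"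
  using bij by (meson bij_betw_imp_inj_on inj_on_eq_iff)

lemma f_surj: "y \<in> carrier V \<Longrightarrow> \<exists>x\<in>carrier U. y = f x"
  using bij unfolding bij_betw_def by blast

lemma sum_iff:
  assumes "x \<in> carrier U" "y \<in> carrier U" "s \<in> carrier U"
  shows "psum U x y = Some s \<longleftrightarrow> psum V (f x) (f y) = Some (f s)"
  using assms U_sum_closed[OF assms(1,2)] by (auto simp: transport f_eq_iff)

lemma U_assoc:
  assumes a: "a \<in> carrier U" and b: "b \<in> carrier U" and c: "c \<in> carrier U"
  shows "Option.bind (psum U a b) (\<lambda>d. psum U d c) = Option.bind (psum U b c) (\<lambda>e. psum U a e)"
    (is "?l = ?r")
proof -
  have "map_option f ?l = Option.bind (psum V (f a) (f b)) (\<lambda>d. psum V d (f c))"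
    using U_sum_closed[OF a b] a b c by (cases "psum U a b") (auto simp: transport)
  also have "\<dots> = Option.bind (psum V (f b) (f c)) (\<lambda>e. psum V (f a) e)"
    using a b c by (intro V.assoc f_closed)
  also have "\<dots> = map_option f ?r"
    using U_sum_closed[OF b c] a b c by (cases "psum U b c") (auto simp: transport)
  finally have eq: "map_option f ?l = map_option f ?r" .
  \<comment> \<open>To cancel \<open>f\<close> from \<open>eq\<close>, any value of either side must
    be placed in \<open>carrier U\<close>, where \<open>f\<close> is injective.\<close>
  have "s \<in> carrier U" if l: "?l = Some s" for s
  proof -
    obtain d where "psum U a b = Some d" "psum U d c = Some s"
      using l unfolding bind_eq_Some_conv by blast
    then show ?thesis using U_sum_closed a b c by metis
  qed
  moreover have "s \<in> carrier U" if r: "?r = Some s" for s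
  proof -
    obtain e where "psum U b c = Some e" "psum U a e = Some s"
      using r unfolding bind_eq_Some_conv by blast
    then show ?thesis using U_sum_closed a b c by metis
  qed
  ultimately show ?thesis using eq by (cases ?l; cases ?r) (auto simp: f_eq_iff)
qed

lemma pea_U: "pea U"
proof unfold_locales
  fix a b assume a: "a \<in> carrier U" and b: "b \<in> carrier U"
  {
    fix s assume s: "psum U a b = Some s"
    then have sU: "s \<in> carrier U" using U_sum_closed a b by blast
    obtain c d where cd: "c \<in> carrier V" "d \<in> carrier V"
      "psum V c (f a) = Some (f s)" "psum V (f b) d = Some (f s)"
      using V.conjugation[of "f a" "f b" "f s"] s a b sU by (auto simp: sum_iff f_closed)
    \<comment> \<open>Witnesses found in V are pulled back by surjectivity.\<close>
    obtain c' d' where "c' \<in> carrier U" "d' \<in> carrier U" "c = f c'" "d = f d'"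
      using cd(1,2) f_surj by meson
    then show "\<exists>c\<in>carrier U. \<exists>d\<in>carrier U. psum U c a = Some s \<and> psum U b d = Some s"
      using cd a b sU sum_iff by metis
  }
  {
    assume "psum U a b = Some (zero U)"
    then show "a = zero U \<and> b = zero U"
      using V.positive[of "f a" "f b"] f_closed f_eq_iff[OF _ U_zero_closed] U_zero_closed
        sum_iff[OF a b U_zero_closed] a b by (simp add: f_zero)
  }
  fix c s assume c: "c \<in> carrier U"
  show "b = c" if "psum U a b = Some s" "psum U a c = Some s"
  proof -
    have "s \<in> carrier U" using U_sum_closed a b that by blast
    then have "f b = f c"
      using V.cancel_left[of "f a" "f b" "f c" "f s"] that a b c by (simp add: sum_iff f_closed)
    then show ?thesis using b c f_eq_iff by blast
  qed
  show "b = c" if "psum U b a = Some s" "psum U c a = Some s"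
  proof -
    have "s \<in> carrier U" using U_sum_closed a b that by blast
    then have "f b = f c"
      using V.cancel_right[of "f a" "f b" "f c" "f s"] that a b c by (simp add: sum_iff f_closed)
    then show ?thesis using b c f_eq_iff by blast
  qed
next
  fix a assume a: "a \<in> carrier U"
  show "psum U a (zero U) = Some a" "psum U (zero U) a = Some a"
    using a U_zero_closed by (simp_all add: sum_iff f_zero f_closed V.sum_zero V.zero_sum)
  obtain c where "c \<in> carrier V" "psum V (f a) c = Some (f (unit U))"
    using V.unit_greatest[OF f_closed[OF a]] unfolding gle_def f_unit by blast
  then show "gle U a (unit U)"
    unfolding gle_def using f_surj sum_iff[OF a _ U_unit_closed] by metis
qed (fact U_assoc U_sum_closed U_zero_closed U_unit_closed)+

lemma inv_f_closed: "x \<in> carrier V \<Longrightarrow> inv_into (carrier U) f x \<in> carrier U"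
  using bij by (metis bij_betw_def inv_into_into)

lemma f_inv_f: "x \<in> carrier V \<Longrightarrow> f (inv_into (carrier U) f x) = x"
  using bij by (metis bij_betw_def f_inv_into_f)

lemma pea_iso_restrict: "restrict f (carrier U) \<in> pea_iso U V"
proof -
  let ?f = "restrict f (carrier U)"
  let ?g = "restrict (inv_into (carrier U) f) (carrier V)"
  have "psum V (?f a) (?f b) = Some (?f s)"
    if "a \<in> carrier U" "b \<in> carrier U" "psum U a b = Some s" for a b s
    using that U_sum_closed[OF that] by (simp add: transport)
  then have "?f \<in> gpea_hom U V"
    unfolding gpea_hom_def using f_closed by auto
  moreover have "bij_betw ?f (carrier U) (carrier V)"
    using bij by (simp cong: bij_betw_cong)
  moreover have "psum U (?g a) (?g b) = Some (?g s)"
    if "a \<in> carrier V" "b \<in> carrier V" "psum V a b = Some s" for a b s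
    using that V.sum_closed[OF that] by (simp add: sum_iff inv_f_closed f_inv_f)
  then have "?g \<in> gpea_hom V U"
    unfolding gpea_hom_def using inv_f_closed by auto
  \<comment> \<open>The choice in \<open>inv_into\<close> ranges over points of
    \<open>carrier U\<close> only, where \<open>?f\<close> and \<open>f\<close> agree.\<close>
  moreover have "restrict (inv_into (carrier U) ?f) (carrier V) = ?g"
    unfolding inv_into_def
    by (rule restrict_ext, rule arg_cong[where f = Eps]) auto
  ultimately show ?thesis
    unfolding pea_iso_def gpea_iso_def
    using pea_U V.pea_axioms U_unit_closed f_unit by simp
qed

end

section \<open>The \<gamma>-unitization and its isomorphism onto V\<close>

locale eta_unitization = unitization P V
  for P :: "('a, 'm) gpea_struct_scheme" and V :: "('a, 'n) pea_struct_scheme" +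
  fixes \<eta> :: "'a \<Rightarrow> 'a"
  assumes \<eta>_inj: "inj_on \<eta> (carrier P)"
    and \<eta>_disjoint: "carrier P \<inter> \<eta> ` carrier P = {}"
begin

abbreviation U :: "'a pea_struct" where
  "U \<equiv> gamma_unitization P (corresponding_aut P V) \<eta>"

lemma \<eta>_notin: "a \<in> carrier P \<Longrightarrow> \<eta> a \<notin> carrier P"
  using \<eta>_disjoint by blast

lemma carrier_U: "carrier U = carrier P \<union> \<eta> ` carrier P"
  and zero_U: "zero U = zero P"
  and unit_U: "unit U = \<eta> (zero P)"
  by (simp_all add: gamma_unitization_def)

lemma psum_U:
  assumes "a \<in> carrier P" "b \<in> carrier P"
  shows "psum U a b = psum P a b"
    and "psum U a (\<eta> b) = (if gle P a b then Some (\<eta> (rdiff P b a)) else None)"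
    and "psum U (\<eta> a) b = (if gle P (corresponding_aut P V b) a
           then Some (\<eta> (ldiff P (corresponding_aut P V b) a)) else None)"
    and "psum U (\<eta> a) (\<eta> b) = None"
  using assms \<eta>_inj by (simp_all add: gamma_unitization_def \<eta>_notin)

lemma U_pair_cases [consumes 2]:
  assumes "x \<in> carrier U" "y \<in> carrier U"
  obtains a b where "a \<in> carrier P" "b \<in> carrier P" "x = a" "y = b"
    | a b where "a \<in> carrier P" "b \<in> carrier P" "x = a" "y = \<eta> b"
    | a b where "a \<in> carrier P" "b \<in> carrier P" "x = \<eta> a" "y = b"
    | a b where "a \<in> carrier P" "b \<in> carrier P" "x = \<eta> a" "y = \<eta> b"
  using assms unfolding carrier_U by blast

lemma sum_\<eta>: "a \<in> carrier P \<Longrightarrow> psum U a (\<eta> a) = Some (unit U)"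
  by (simp add: psum_U gle_refl rdiff_self unit_U)

text \<open>Written with the inverse of \<eta> instead of left supplements in U, so that it can be
  handled before U is known to be a PEA.\<close>

definition iso :: "'a \<Rightarrow> 'a" where
  "iso x = (if x \<in> carrier P then x else rsupp V (inv_into (carrier P) \<eta> x))"

lemma iso_simps: "a \<in> carrier P \<Longrightarrow> iso a = a" "a \<in> carrier P \<Longrightarrow> iso (\<eta> a) = rsupp V a"
  using \<eta>_inj by (simp_all add: iso_def \<eta>_notin)

lemma bij_iso: "bij_betw iso (carrier U) (carrier V)"
proof -
  have "bij_betw iso (carrier P) (carrier P)"
    by (rule bij_betw_byWitness[of _ id]) (auto simp: iso_simps)
  \<comment> \<open>Supplements exchange P with its complement in V, so \<eta> of the left
    supplement inverts \<open>iso\<close> there.\<close>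
  moreover have "bij_betw iso (\<eta> ` carrier P) (carrier V - carrier P)"
    by (rule bij_betw_byWitness[of _ "\<lambda>x. \<eta> (lsupp V x)"])
      (auto simp: iso_simps V.lsupp_rsupp V.rsupp_lsupp mem_V V.rsupp_closed V.lsupp_closed
        rsupp_mem_iff lsupp_mem_iff)
  ultimately have "bij_betw iso (carrier U) (carrier P \<union> (carrier V - carrier P))"
    unfolding carrier_U by (rule bij_betw_combine) blast
  then show ?thesis using subset by (simp add: Un_absorb1)
qed

sublocale sum_transport U V iso
proof
  show "bij_betw iso (carrier U) (carrier V)" by (rule bij_iso)
  show "zero U \<in> carrier U" "iso (zero U) = zero V" "unit U \<in> carrier U" "iso (unit U) = unit V"
    using zero_closed V.rsupp_zero by (simp_all add: carrier_U zero_U unit_U iso_simps same_zero)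
next
  fix x y s assume "x \<in> carrier U" "y \<in> carrier U" "psum U x y = Some s"
  then show "s \<in> carrier U"
  proof (cases rule: U_pair_cases)
    case (1 a b)
    then show ?thesis
      using sum_closed[of a b s] \<open>psum U x y = Some s\<close> by (simp add: carrier_U psum_U)
  qed (auto simp: carrier_U psum_U rdiff_closed ldiff_closed corresponding_aut_closed
      split: if_splits)
next
  \<comment> \<open>The cases are the four clauses defining the sum of U; the mixed ones match
    \<open>sum_rsupp_right\<close> and \<open>sum_rsupp_left\<close>, and the last matches
    \<open>no_sum\<close>.\<close>
  fix x y assume "x \<in> carrier U" "y \<in> carrier U"
  then show "psum V (iso x) (iso y) = map_option iso (psum U x y)"
  proof (cases rule: U_pair_cases)
    case (1 a b)
    then show ?thesis using sum_closed[of a b]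
      by (cases "psum P a b") (simp_all add: iso_simps psum_U same_sum)
  next
    case 2
    then show ?thesis by (simp add: iso_simps psum_U sum_rsupp_right rdiff_closed)
  next
    case 3
    then show ?thesis
      by (simp add: iso_simps psum_U sum_rsupp_left ldiff_closed corresponding_aut_closed)
  next
    case 4
    then show ?thesis
      by (simp add: iso_simps psum_U no_sum rsupp_mem_iff V.rsupp_closed mem_V)
  qed
qed

text \<open>This identifies \<open>iso\<close> with the map given by supplements in U and V.
  Uniqueness of supplements in U comes from \<open>pea_U\<close>.\<close>

lemma lsupp_U_\<eta>: "a \<in> carrier P \<Longrightarrow> lsupp U (\<eta> a) = a"
  by (rule pea.lsupp_eqI[OF pea_U]) (simp_all add: carrier_U sum_\<eta>)

lemma iso_unique:
  assumes \<psi>: "\<psi> \<in> pea_iso U V" and id: "\<And>a. a \<in> carrier P \<Longrightarrow> \<psi> a = a"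
  shows "\<psi> = restrict iso (carrier U)"
proof (rule extensionalityI[of _ "carrier U"])
  have \<psi>_iso: "\<psi> \<in> gpea_iso U V" and \<psi>_unit: "\<psi> (unit U) = unit V"
    using \<psi> by (auto simp: pea_iso_def)
  then have \<psi>_E: "\<psi> \<in> carrier U \<rightarrow>\<^sub>E carrier V" by (simp add: gpea_iso_def gpea_hom_def)
  then show "\<psi> \<in> extensional (carrier U)" by (simp add: PiE_def)
  show "restrict iso (carrier U) \<in> extensional (carrier U)" by simp
  fix x assume x: "x \<in> carrier U"
  show "\<psi> x = restrict iso (carrier U) x"
  proof (cases "x \<in> carrier P")
    case True
    then show ?thesis using x by (simp add: id iso_simps)
  next
    case False
    then obtain a where a: "a \<in> carrier P" "x = \<eta> a" using x carrier_U by blast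
    \<comment> \<open>Apply \<psi> to a + \<eta> a = 1, using that \<psi> fixes a; then \<psi> x can
      only be the right supplement of a in V.\<close>
    then have "psum V a (\<psi> x) = Some (unit V)"
      using gpea_isoD[OF \<psi>_iso _ x, of a] sum_\<eta>[of a] \<psi>_unit by (simp add: id carrier_U)
    then have "rsupp V a = \<psi> x" using a \<psi>_E x by (intro V.rsupp_eqI) (auto simp: mem_V)
    then show ?thesis using a x by (simp add: iso_simps)
  qed
qed

end

theorem theorem3p4:
  fixes P :: "('a, 'm) gpea_struct_scheme" and V :: "('a, 'n) pea_struct_scheme"
    and U :: "'a pea_struct" and \<gamma> \<eta> \<phi> :: "'a \<Rightarrow> 'a"
  assumes V: "unitization P V"
    and \<gamma>: "\<gamma> = corresponding_aut P V"
    and \<eta>_inj: "inj_on \<eta> (carrier P)"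
    and \<eta>_disjoint: "carrier P \<inter> \<eta> ` carrier P = {}"
    and U: "U = gamma_unitization P \<gamma> \<eta>"
    and \<phi>: "\<phi> = (\<lambda>x\<in>carrier U. if x \<in> carrier P then x else rsupp V (lsupp U x))"
  shows "(\<exists>!\<psi>. \<psi> \<in> pea_iso U V \<and> (\<forall>a\<in>carrier P. \<psi> a = a))
    \<and> \<phi> \<in> pea_iso U V \<and> (\<forall>a\<in>carrier P. \<phi> a = a)"
proof -
  interpret E: eta_unitization P V \<eta>
    using V \<eta>_inj \<eta>_disjoint by (simp add: eta_unitization_def eta_unitization_axioms_def)
  have U: "U = E.U" using U \<gamma> by simp
  have "\<phi> = restrict E.iso (carrier U)"
    unfolding \<phi> U
    by (rule restrict_ext) (auto simp: E.carrier_U E.iso_simps E.lsupp_U_\<eta> E.\<eta>_notin)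
  moreover from this have "\<phi> \<in> pea_iso U V" using E.pea_iso_restrict U by simp
  moreover have "\<forall>a\<in>carrier P. \<phi> a = a" using \<phi> U by (simp add: E.carrier_U)
  ultimately show ?thesis using E.iso_unique U by blast
qed

end
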